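(* Fix $z\in V$, and let $G$ be an edge independent random cost graph on the finite vertex set $V$, with distance $d$. Then there exists a solution $\tilde w$ to the system of equations $$w(x)=\mathbf{E}[T^z(x;\mathcal F_w)]\qquad (x\in V),$$ so that cost-greedy search for $z$ is well defined. Moreover, $\tilde w$ is a globally attractive fixed point of the iteration given by $$w_{i+1}(x)=\mathbf{E}[T^z(x;\mathcal F_{w_i})]\qquad (x\in V),$$ started from any collection of weights $w_0$.
   Context: Distance. A distance on $V$ is a function $d:V\times V\to[0,\infty)$ such that $d(x,y)=0$ implies $x=y$, and $d(x,y)\le d(x,u)+d(u,y)$ for all $x,u,y\in V$; it is thus a metric without the symmetry requirement. Random cost graph. A cost graph $G=(V,E,C)$ consists of a vertex set $V$, a possibly directed set of edges $E$, and a collection of costs $C$: for each $(x,y)\in E$, $C(x,y)$ is an i.i.d. positive random variable giving the cost of traveling down that edge. $G$ may be a random graph: for each $x,y\in V$ there is a random indicator variable $E_{x,y}$ saying whether there is an edge from $x$ to $y$. $N(x)$ is the set of neighbors of $x$, i.e. vertices at graph distance $1$ from $x$. Adapted. A distance $d$ is adapted for search in a connected graph if for all $x,z\in V$ with $x\ne z$ there is $y\in N(x)$ with $d(y,z)<d(x,z)$. Edge independent. Let $y\leadsto x$ denote the event that there is an edge from $y$ to $x$ (multiple edges per pair are allowed). With $z$ fixed, the random graph $G$ is edge independent if $d$ is adapted for search in $G$ with probability 1 and, for all $y,x,v,u\in V$ with $d(y,z)>d(x,z)$ and $d(v,z)>d(u,z)$, the event $y\leadsto x$ is independent of the event $v\leadsto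 u$ whenever $y\ne v$. Searches. A $z$-search is a mapping $\mathcal A:V\to V$ such that $\mathcal A(x)=y$ only if $(x,y)\in E$; $\mathcal A(z)=z$; and for every $x\in V$ there is $k<\infty$ with $\mathcal A^k(x)=z$. (The condition $\mathcal A(z)=z$ does not require an edge from $z$ to itself.) It is a forward search if $d(\mathcal A(x),z)<d(x,z)$ for all $x\in V\setminus\{z\}$. Steps and cost. $S^z(x;\mathcal A)=\inf\{k:\mathcal A^k(x)=z\}$ and $T^z(x;\mathcal A)=\sum_{i=1}^{S^z(x;\mathcal A)}C(\mathcal A^{i-1}(x),\mathcal A^i(x))$, where $\mathcal A^0(x)=x$. Weights and weighted greedy forward search. A collection of weights is a family $w=(w(x))_{x\in V}$ with $w(z)=0$. It specifies the forward search $\mathcal F_w$ with $\mathcal F_w(z)=z$ and, for $x\ne z$, $$\mathcal F_w(x)=\operatorname{argmin}\{C(x,y)+w(y): y\in N(x),\ d(y,z)<d(x,z)\}.$$ Cost-greedy search. A forward search $\mathcal F$ is called cost-greedy search for $z$ if $\mathcal F=\mathcal F_{\tilde w}$, where the weights $\tilde w$ are given by the solution of $w(x)=\mathbf{E}[T^z(x;\mathcal F_w)]$, $x\in V$. *)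

theory Defs
  imports "HOL-Probability.Probability"
begin

text \<open>
  The value of a distance at a pair (x, x) is not prescribed: only the implication from
  zero distance to equality is required.
\<close>

definition distance :: "('v \<Rightarrow> 'v \<Rightarrow> real) \<Rightarrow> bool" where
  "distance d \<longleftrightarrow>
     (\<forall>x y. 0 \<le> d x y) \<and>
     (\<forall>x y. d x y = 0 \<longrightarrow> x = y) \<and>
     (\<forall>x u y. d x y \<le> d x u + d u y)"


section \<open>Search in a fixed cost graph\<close>

text \<open>
  A realised cost graph consists of a set of ordered pairs \<open>E\<close> and the cost \<open>c x y\<close> of going
  from \<open>x\<close> to \<open>y\<close>, which is only meaningful for pairs in \<open>E\<close>.
\<close>

definition nbrs :: "('v \<times> 'v) set \<Rightarrow> 'v \<Rightarrow> 'v set" where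
  "nbrs E x = {y. y \<noteq> x \<and> (x, y) \<in> E}"

text \<open>
  Connectedness is not a separate clause below: on a finite vertex set an adapted distance makes
  every vertex reachable from every other one.
\<close>

definition adapted :: "('v \<Rightarrow> 'v \<Rightarrow> real) \<Rightarrow> ('v \<times> 'v) set \<Rightarrow> bool" where
  "adapted d E \<longleftrightarrow> (\<forall>x z. x \<noteq> z \<longrightarrow> (\<exists>y\<in>nbrs E x. d y z < d x z))"

definition z_search :: "('v \<times> 'v) set \<Rightarrow> 'v \<Rightarrow> ('v \<Rightarrow> 'v) \<Rightarrow> bool" where
  "z_search E z A \<longleftrightarrow>
     (\<forall>x. x \<noteq> z \<longrightarrow> (x, A x) \<in> E) \<and> A z = z \<and> (\<forall>x. \<exists>k. (A ^^ k) x = z)"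

definition forward_search ::
  "('v \<Rightarrow> 'v \<Rightarrow> real) \<Rightarrow> ('v \<times> 'v) set \<Rightarrow> 'v \<Rightarrow> ('v \<Rightarrow> 'v) \<Rightarrow> bool" where
  "forward_search d E z A \<longleftrightarrow> z_search E z A \<and> (\<forall>x. x \<noteq> z \<longrightarrow> d (A x) z < d x z)"

definition search_steps :: "'v \<Rightarrow> ('v \<Rightarrow> 'v) \<Rightarrow> 'v \<Rightarrow> enat" where
  "search_steps z A x = (INF k\<in>{k. (A ^^ k) x = z}. enat k)"

definition search_cost ::
  "('v \<Rightarrow> 'v \<Rightarrow> real) \<Rightarrow> 'v \<Rightarrow> ('v \<Rightarrow> 'v) \<Rightarrow> 'v \<Rightarrow> ennreal" where
  "search_cost c z A x =
     (\<Sum>i. if enat i < search_steps z A x then ennreal (c ((A ^^ i) x) ((A ^^ Suc i) x)) else 0)"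

text \<open>
  Weights are extended reals, because no moment condition is imposed on the edge costs and the
  expected cost of a search may therefore be infinite.
\<close>

definition weights :: "'v \<Rightarrow> ('v \<Rightarrow> ereal) \<Rightarrow> bool" where
  "weights z w \<longleftrightarrow> w z = 0"

definition greedy_choices ::
  "('v \<Rightarrow> 'v \<Rightarrow> real) \<Rightarrow> ('v \<times> 'v) set \<Rightarrow> ('v \<Rightarrow> 'v \<Rightarrow> real) \<Rightarrow> 'v \<Rightarrow> ('v \<Rightarrow> ereal) \<Rightarrow> 'v \<Rightarrow> 'v set"
  where
  "greedy_choices d E c z w x =
     {y. is_arg_min (\<lambda>y. ereal (c x y) + w y) (\<lambda>y. y \<in> nbrs E x \<and> d y z < d x z) y}"

text \<open>
  The minimiser need not be unique (the cost distribution may have atoms), so a rule is fixed that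
  selects one of the minimisers at each vertex.
\<close>

definition tie_rule :: "('v \<Rightarrow> 'v set \<Rightarrow> 'v) \<Rightarrow> bool" where
  "tie_rule tie \<longleftrightarrow> (\<forall>x S. S \<noteq> {} \<longrightarrow> tie x S \<in> S)"

definition weighted_greedy ::
  "('v \<Rightarrow> 'v set \<Rightarrow> 'v) \<Rightarrow> ('v \<Rightarrow> 'v \<Rightarrow> real) \<Rightarrow> ('v \<times> 'v) set \<Rightarrow> ('v \<Rightarrow> 'v \<Rightarrow> real) \<Rightarrow> 'v \<Rightarrow>
     ('v \<Rightarrow> ereal) \<Rightarrow> 'v \<Rightarrow> 'v" where
  "weighted_greedy tie d E c z w x =
     (if x = z then z else tie x (greedy_choices d E c z w x))"


section \<open>Random cost graphs\<close>

text \<open>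
  \<open>nedges x y \<omega>\<close> is the number of parallel edges from \<open>x\<close> to \<open>y\<close> and \<open>C x y k \<omega>\<close> is the cost of the
  edge with label \<open>k < nedges x y \<omega>\<close>.  The cost of going from \<open>x\<close> to \<open>y\<close> is that of the cheapest
  parallel edge; if multiplicities are at most 1, then \<open>nedges\<close> is the family of edge indicators and
  this is just the cost of the edge.

  The costs are indexed by all potential edges.  In the directed case they are i.i.d. over ordered
  pairs and labels.  The second disjunct of the last locale assumption is the undirected case,
  where an edge has the same cost in both directions and the costs are i.i.d. over unordered
  pairs and labels.
\<close>

locale random_cost_graph = prob_space M
  for M :: "'a measure" +
  fixes nedges :: "'v::finite \<Rightarrow> 'v \<Rightarrow> 'a \<Rightarrow> nat"
    and C :: "'v \<Rightarrow> 'v \<Rightarrow> nat \<Rightarrow> 'a \<Rightarrow> real"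
  assumes nedges_measurable: "nedges x y \<in> measurable M (count_space UNIV)"
    and cost_measurable: "C x y k \<in> borel_measurable M"
    and cost_positive: "AE \<omega> in M. 0 < C x y k \<omega>"
    and cost_identically_distributed: "distr M borel (C x y k) = distr M borel (C x' y' k')"
    and cost_independent:
      "indep_vars (\<lambda>_. borel) (\<lambda>(x, y, k). C x y k) UNIV \<or>
       (\<forall>x y. nedges x y = nedges y x) \<and>
       (\<exists>c. (\<forall>x y k. C x y k = c {x, y} k) \<and>
            indep_vars (\<lambda>_. borel) (\<lambda>(e, k). c e k) ({{x, y} | x y. True} \<times> UNIV))"

definition edge_set :: "('v \<Rightarrow> 'v \<Rightarrow> 'a \<Rightarrow> nat) \<Rightarrow> 'a \<Rightarrow> ('v \<times> 'v) set" where
  "edge_set nedges \<omega> = {(x, y). 0 < nedges x y \<omega>}"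

definition edge_cost ::
  "('v \<Rightarrow> 'v \<Rightarrow> 'a \<Rightarrow> nat) \<Rightarrow> ('v \<Rightarrow> 'v \<Rightarrow> nat \<Rightarrow> 'a \<Rightarrow> real) \<Rightarrow> 'a \<Rightarrow> 'v \<Rightarrow> 'v \<Rightarrow> real" where
  "edge_cost nedges C \<omega> x y = (MIN k\<in>{..<nedges x y \<omega>}. C x y k \<omega>)"

definition edge_event ::
  "'a measure \<Rightarrow> ('v \<Rightarrow> 'v \<Rightarrow> 'a \<Rightarrow> nat) \<Rightarrow> 'v \<Rightarrow> 'v \<Rightarrow> 'a set" where
  "edge_event M nedges y x = {\<omega> \<in> space M. (y, x) \<in> edge_set nedges \<omega>}"

definition edge_independent ::
  "'a measure \<Rightarrow> ('v \<Rightarrow> 'v \<Rightarrow> 'a \<Rightarrow> nat) \<Rightarrow> ('v \<Rightarrow> 'v \<Rightarrow> real) \<Rightarrow> 'v \<Rightarrow> bool" where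
  "edge_independent M nedges d z \<longleftrightarrow>
     (AE \<omega> in M. adapted d (edge_set nedges \<omega>)) \<and>
     (\<forall>y x v u. d x z < d y z \<longrightarrow> d u z < d v z \<longrightarrow> y \<noteq> v \<longrightarrow>
        prob_space.indep_event M (edge_event M nedges y x) (edge_event M nedges v u))"

definition greedy_search ::
  "('v \<Rightarrow> 'v set \<Rightarrow> 'v) \<Rightarrow> ('v \<Rightarrow> 'v \<Rightarrow> 'a \<Rightarrow> nat) \<Rightarrow> ('v \<Rightarrow> 'v \<Rightarrow> nat \<Rightarrow> 'a \<Rightarrow> real) \<Rightarrow>
     ('v \<Rightarrow> 'v \<Rightarrow> real) \<Rightarrow> 'v \<Rightarrow> ('v \<Rightarrow> ereal) \<Rightarrow> 'a \<Rightarrow> 'v \<Rightarrow> 'v" where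
  "greedy_search tie nedges C d z w \<omega> =
     weighted_greedy tie d (edge_set nedges \<omega>) (edge_cost nedges C \<omega>) z w"

definition expected_cost ::
  "'a measure \<Rightarrow> ('v \<Rightarrow> 'v \<Rightarrow> 'a \<Rightarrow> nat) \<Rightarrow> ('v \<Rightarrow> 'v \<Rightarrow> nat \<Rightarrow> 'a \<Rightarrow> real) \<Rightarrow>
     'v \<Rightarrow> ('a \<Rightarrow> 'v \<Rightarrow> 'v) \<Rightarrow> 'v \<Rightarrow> ereal" where
  "expected_cost M nedges C z F x =
     enn2ereal (\<integral>\<^sup>+ \<omega>. search_cost (edge_cost nedges C \<omega>) z (F \<omega>) x \<partial>M)"

definition weight_step ::
  "'a measure \<Rightarrow> ('v \<Rightarrow> 'v set \<Rightarrow> 'v) \<Rightarrow> ('v \<Rightarrow> 'v \<Rightarrow> 'a \<Rightarrow> nat) \<Rightarrow>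
     ('v \<Rightarrow> 'v \<Rightarrow> nat \<Rightarrow> 'a \<Rightarrow> real) \<Rightarrow> ('v \<Rightarrow> 'v \<Rightarrow> real) \<Rightarrow> 'v \<Rightarrow> ('v \<Rightarrow> ereal) \<Rightarrow> 'v \<Rightarrow> ereal" where
  "weight_step M tie nedges C d z w x = expected_cost M nedges C z (greedy_search tie nedges C d z w) x"

definition cost_greedy_weights ::
  "'a measure \<Rightarrow> ('v \<Rightarrow> 'v set \<Rightarrow> 'v) \<Rightarrow> ('v \<Rightarrow> 'v \<Rightarrow> 'a \<Rightarrow> nat) \<Rightarrow>
     ('v \<Rightarrow> 'v \<Rightarrow> nat \<Rightarrow> 'a \<Rightarrow> real) \<Rightarrow> ('v \<Rightarrow> 'v \<Rightarrow> real) \<Rightarrow> 'v \<Rightarrow> ('v \<Rightarrow> ereal) \<Rightarrow> bool" where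
  "cost_greedy_weights M tie nedges C d z w \<longleftrightarrow>
     weights z w \<and> (\<forall>x. w x = weight_step M tie nedges C d z w x)"

definition cost_greedy_search ::
  "'a measure \<Rightarrow> ('v \<Rightarrow> 'v set \<Rightarrow> 'v) \<Rightarrow> ('v \<Rightarrow> 'v \<Rightarrow> 'a \<Rightarrow> nat) \<Rightarrow>
     ('v \<Rightarrow> 'v \<Rightarrow> nat \<Rightarrow> 'a \<Rightarrow> real) \<Rightarrow> ('v \<Rightarrow> 'v \<Rightarrow> real) \<Rightarrow> 'v \<Rightarrow> ('a \<Rightarrow> 'v \<Rightarrow> 'v) \<Rightarrow> bool" where
  "cost_greedy_search M tie nedges C d z F \<longleftrightarrow>
     (AE \<omega> in M. forward_search d (edge_set nedges \<omega>) z (F \<omega>)) \<and>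
     (\<exists>w. cost_greedy_weights M tie nedges C d z w \<and> F = greedy_search tie nedges C d z w)"

end

theory Submission
  imports Defs
begin

text \<open>
  The expected cost of a weighted greedy forward search from \<open>x\<close> depends on the weights only through
  their values at the vertices strictly closer to \<open>z\<close> than \<open>x\<close>. Indeed, almost surely the path from
  \<open>x\<close> never visits a vertex farther from \<open>z\<close> than \<open>x\<close>, and the choice made at a vertex \<open>u\<close> compares
  only candidates that are strictly closer to \<open>z\<close> than \<open>u\<close> (lemma \<open>weight_step_cong\<close>).

  Hence the system of equations is triangular with respect to the order by distance to \<open>z\<close>. The
  weight of a vertex with \<open>n\<close> vertices strictly closer to \<open>z\<close> is determined after \<open>n + 1\<close> iterations,
  whatever the initial weights, and so on a finite vertex set the iteration is not merely
  convergent: it is constant from step \<open>CARD('v)\<close> onwards (lemma \<open>triangular_iteration\<close>). Its final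
  value is the unique solution, and this gives existence, uniqueness and attraction together.
  As all these arguments compare integrands almost surely, they hold just as well if some of the
  expected costs are infinite.

  The weights are finite if the costs are integrable, because a forward search reaches \<open>z\<close>
  within \<open>CARD('v)\<close> steps, and each step costs at most as much as the first of the parallel edges.
\<close>

section \<open>Triangular iterations\<close>

definition rank_by :: "('v::finite \<Rightarrow> 'b::linorder) \<Rightarrow> 'v \<Rightarrow> nat" where
  "rank_by r x = card {y. r y < r x}"

lemma rank_by_strict_mono:
  assumes "r y < r x"
  shows "rank_by r y < rank_by r x"
  unfolding rank_by_def using assms by (intro psubset_card_mono) auto

lemma rank_by_less_CARD: "rank_by r (x :: 'v::finite) < CARD('v)"
  unfolding rank_by_def by (intro psubset_card_mono) auto

lemma triangular_iteration_forgets_start: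
  fixes T :: "('v::finite \<Rightarrow> 'c) \<Rightarrow> 'v \<Rightarrow> 'c" and r :: "'v \<Rightarrow> 'b::linorder"
  assumes T: "\<And>w w' x. (\<And>y. r y < r x \<Longrightarrow> w y = w' y) \<Longrightarrow> T w x = T w' x"
    and "rank_by r x < i" and "rank_by r x < j"
  shows "(T ^^ i) w x = (T ^^ j) w' x"
  using assms(2,3)
proof (induction i arbitrary: j x)
  case (Suc i)
  then obtain j' where j: "j = Suc j'"
    by (cases j) auto
  have "T ((T ^^ i) w) x = T ((T ^^ j') w') x"
  proof (rule T)
    fix y assume "r y < r x"
    then have "rank_by r y < rank_by r x"
      by (rule rank_by_strict_mono)
    then show "(T ^^ i) w y = (T ^^ j') w' y"
      using Suc.prems j by (intro Suc.IH) auto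
  qed
  then show ?case
    by (simp add: j)
qed simp

text \<open>
  Comparing two numbers of iterations from two starting points covers both claims at once: equal
  starts with consecutive numbers yield the fixed point, different starts yield attraction.
\<close>

lemma triangular_iteration:
  fixes T :: "('v::finite \<Rightarrow> 'c) \<Rightarrow> 'v \<Rightarrow> 'c" and r :: "'v \<Rightarrow> 'b::linorder"
  assumes T: "\<And>w w' x. (\<And>y. r y < r x \<Longrightarrow> w y = w' y) \<Longrightarrow> T w x = T w' x"
  obtains w where "T w = w" and "\<And>w0 i. CARD('v) \<le> i \<Longrightarrow> (T ^^ i) w0 = w"
proof -
  define w where "w = (T ^^ CARD('v)) undefined"
  have stable: "(T ^^ i) w0 = w" if "CARD('v) \<le> i" for w0 i
  proof
    fix x
    have "rank_by r x < CARD('v)"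
      by (rule rank_by_less_CARD)
    with that show "(T ^^ i) w0 x = w x"
      unfolding w_def by (intro triangular_iteration_forgets_start[where r = r] T) auto
  qed
  have "T w = (T ^^ Suc CARD('v)) undefined"
    by (simp add: w_def)
  also have "\<dots> = w"
    by (rule stable) simp
  finally show ?thesis
    using stable by (rule that)
qed

lemma descending_funpow_reaches:
  fixes r :: "'v::finite \<Rightarrow> 'b::linorder"
  assumes desc: "\<And>u. u \<noteq> z \<Longrightarrow> r (A u) < r u" and fixed: "A z = z"
  shows "(A ^^ CARD('v)) x = z"
proof -
  have z: "(A ^^ n) z = z" for n
    by (induction n) (auto simp: fixed)
  have "(A ^^ n) x = z" if "rank_by r x < n" for n
    using that
  proof (induction n arbitrary: x)
    case (Suc n)
    show ?case
    proof (cases "x = z")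
      case False
      then have "rank_by r (A x) < rank_by r x"
        by (intro rank_by_strict_mono desc)
      then have "(A ^^ n) (A x) = z"
        using Suc.prems by (intro Suc.IH) simp
      then show ?thesis
        by (simp add: funpow_swap1)
    qed (simp only: z)
  qed simp
  then show ?thesis
    using rank_by_less_CARD by blast
qed


section \<open>Search in a fixed cost graph\<close>

lemma search_steps_le: "(A ^^ n) x = z \<Longrightarrow> search_steps z A x \<le> enat n"
  unfolding search_steps_def by (rule INF_lower) simp

lemma search_cost_target [simp]: "search_cost c z A z = 0"
proof -
  have "search_steps z A z = 0"
    using search_steps_le[where A = A and n = 0 and x = z and z = z] by (simp add: zero_enat_def[symmetric])
  then show ?thesis
    by (simp add: search_cost_def)
qed

lemma search_cost_cong:
  assumes "\<And>i. (A ^^ i) x = (B ^^ i) x"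
  shows "search_cost c z A x = search_cost c z B x"
  unfolding search_cost_def search_steps_def by (simp only: assms)

lemma search_cost_bound:
  assumes reach: "(A ^^ n) x = z"
    and bound: "\<And>u. u \<noteq> z \<Longrightarrow> ennreal (c u (A u)) \<le> b"
  shows "search_cost c z A x \<le> of_nat n * b"
proof -
  let ?t = "\<lambda>i. if enat i < search_steps z A x
    then ennreal (c ((A ^^ i) x) ((A ^^ Suc i) x)) else 0"
  have "?t i = 0" if "i \<notin> {..<n}" for i
    using that search_steps_le[OF reach] by (auto dest: order.strict_trans2)
  then have "search_cost c z A x = (\<Sum>i<n. ?t i)"
    unfolding search_cost_def by (intro suminf_finite) auto
  also have "\<dots> \<le> (\<Sum>i<n. b)"
  proof (rule sum_mono)
    fix i
    have "(A ^^ i) x \<noteq> z" if "enat i < search_steps z A x"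
      using that search_steps_le[where A = A and n = i and x = x and z = z] by auto
    then show "?t i \<le> b"
      by (auto intro: bound)
  qed
  finally show ?thesis
    by simp
qed

lemma weighted_greedy_target [simp]: "weighted_greedy tie d E c z w z = z"
  by (simp add: weighted_greedy_def)

lemma weighted_greedy_cong:
  assumes "\<And>y. d y z < d u z \<Longrightarrow> w y = w' y"
  shows "weighted_greedy tie d E c z w u = weighted_greedy tie d E c z w' u"
proof -
  have "greedy_choices d E c z w u = greedy_choices d E c z w' u"
    unfolding greedy_choices_def is_arg_min_def using assms by auto
  then show ?thesis
    by (simp add: weighted_greedy_def)
qed

text \<open>
  On a finite vertex set the infimum over the candidates is attained even if weights are infinite,
  so the only thing that could fail is that there is no candidate; adaptedness provides one.
\<close>

lemma weighted_greedy_candidate: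
  fixes E :: "('v::finite \<times> 'v) set"
  assumes "adapted d E" and "tie_rule tie" and "u \<noteq> z"
  shows "weighted_greedy tie d E c z w u \<in> nbrs E u"
    and "d (weighted_greedy tie d E c z w u) z < d u z"
proof -
  have "{y. y \<in> nbrs E u \<and> d y z < d u z} \<noteq> {}"
    using assms by (auto simp: adapted_def)
  then have "greedy_choices d E c z w u \<noteq> {}"
    using ex_is_arg_min_if_finite[of "{y. y \<in> nbrs E u \<and> d y z < d u z}"
        "\<lambda>y. ereal (c u y) + w y"]
    by (auto simp: greedy_choices_def)
  then have "tie u (greedy_choices d E c z w u) \<in> greedy_choices d E c z w u"
    using assms by (simp add: tie_rule_def)
  then have "weighted_greedy tie d E c z w u \<in> greedy_choices d E c z w u"
    using assms by (simp add: weighted_greedy_def)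
  then show "weighted_greedy tie d E c z w u \<in> nbrs E u"
    and "d (weighted_greedy tie d E c z w u) z < d u z"
    by (auto simp: greedy_choices_def is_arg_min_def)
qed

lemma weighted_greedy_reaches:
  fixes E :: "('v::finite \<times> 'v) set"
  assumes "adapted d E" and "tie_rule tie"
  shows "(weighted_greedy tie d E c z w ^^ CARD('v)) x = z"
  using assms
  by (intro descending_funpow_reaches[where r = "\<lambda>u. d u z"] weighted_greedy_candidate(2)) auto

lemma weighted_greedy_forward_search:
  fixes E :: "('v::finite \<times> 'v) set"
  assumes "adapted d E" and "tie_rule tie"
  shows "forward_search d E z (weighted_greedy tie d E c z w)"
  using weighted_greedy_candidate[OF assms] weighted_greedy_reaches[OF assms]
  unfolding forward_search_def z_search_def nbrs_def by (auto intro: exI[of _ "CARD('v)"])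

lemma weighted_greedy_search_cost_cong:
  fixes E :: "('v::finite \<times> 'v) set"
  assumes "adapted d E" and "tie_rule tie"
    and agree: "\<And>y. d y z < d x z \<Longrightarrow> w y = w' y"
  shows "search_cost c z (weighted_greedy tie d E c z w) x =
         search_cost c z (weighted_greedy tie d E c z w') x"
proof (rule search_cost_cong)
  let ?A = "weighted_greedy tie d E c z"
  have desc: "d (?A w u) z \<le> d u z" for u
    using weighted_greedy_candidate(2)[OF assms(1,2), of u z c w] by (cases "u = z") auto
  fix i
  have "(?A w ^^ i) x = (?A w' ^^ i) x \<and> d ((?A w ^^ i) x) z \<le> d x z"
  proof (induction i)
    case (Suc i)
    define u where "u = (?A w ^^ i) x"
    have u: "u = (?A w' ^^ i) x" "d u z \<le> d x z"
      using Suc.IH by (auto simp: u_def)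
    have "?A w u = ?A w' u"
      using u(2) by (intro weighted_greedy_cong agree) simp
    moreover have "d (?A w u) z \<le> d x z"
      using desc u(2) by (rule order.trans)
    ultimately show ?case
      by (simp add: u_def[symmetric] u(1)[symmetric])
  qed simp
  then show "(?A w ^^ i) x = (?A w' ^^ i) x" ..
qed


section \<open>The expected cost as a function of the weights\<close>

lemma weight_step_target [simp]: "weight_step M tie nedges C d z w z = 0"
  by (simp add: weight_step_def expected_cost_def zero_ennreal.rep_eq)

lemma weight_step_cong:
  fixes nedges :: "'v::finite \<Rightarrow> 'v \<Rightarrow> 'a \<Rightarrow> nat"
  assumes "AE \<omega> in M. adapted d (edge_set nedges \<omega>)" and "tie_rule tie"
    and "\<And>y. d y z < d x z \<Longrightarrow> w y = w' y"
  shows "weight_step M tie nedges C d z w x = weight_step M tie nedges C d z w' x"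
proof -
  have "AE \<omega> in M.
      search_cost (edge_cost nedges C \<omega>) z (greedy_search tie nedges C d z w \<omega>) x =
      search_cost (edge_cost nedges C \<omega>) z (greedy_search tie nedges C d z w' \<omega>) x"
    using assms(1) unfolding greedy_search_def
    by eventually_elim (rule weighted_greedy_search_cost_cong[OF _ assms(2,3)])
  then show ?thesis
    unfolding weight_step_def expected_cost_def by (simp cong: nn_integral_cong_AE)
qed

text \<open>
  The label of the cheapest parallel edge is random and may depend on the costs, so the cost of a
  step has no prescribed distribution; comparison with the edge labelled \<open>0\<close>, which is present
  whenever any parallel edge is, gives an integrable bound.
\<close>

lemma edge_cost_le_first:
  assumes "(x, y) \<in> edge_set nedges \<omega>"
  shows "edge_cost nedges C \<omega> x y \<le> C x y 0 \<omega>"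
  using assms unfolding edge_cost_def edge_set_def by (intro Min_le) auto

lemma weight_step_finite:
  fixes nedges :: "'v::finite \<Rightarrow> 'v \<Rightarrow> 'a \<Rightarrow> nat"
  assumes "AE \<omega> in M. adapted d (edge_set nedges \<omega>)" and "tie_rule tie"
    and int: "\<And>x y. integrable M (C x y 0)"
  shows "\<bar>weight_step M tie nedges C d z w x\<bar> \<noteq> \<infinity>"
proof -
  define b where "b = (\<lambda>\<omega>. \<Sum>x\<in>UNIV. \<Sum>y\<in>UNIV. ennreal (C x y 0 \<omega>))"
  have [measurable]: "C x y 0 \<in> borel_measurable M" for x y
    using int by (rule borel_measurable_integrable)
  have le_b: "ennreal (C x y 0 \<omega>) \<le> b \<omega>" for x y \<omega>
  proof -
    have "ennreal (C x y 0 \<omega>) \<le> (\<Sum>y\<in>UNIV. ennreal (C x y 0 \<omega>))"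
      by (rule member_le_sum) auto
    also have "\<dots> \<le> b \<omega>"
      unfolding b_def
      by (rule member_le_sum[where f = "\<lambda>x. \<Sum>y\<in>UNIV. ennreal (C x y 0 \<omega>)"]) auto
    finally show ?thesis .
  qed
  have "(\<integral>\<^sup>+ \<omega>. ennreal (C x y 0 \<omega>) \<partial>M) < \<top>" for x y
  proof -
    have "(\<integral>\<^sup>+ \<omega>. ennreal (C x y 0 \<omega>) \<partial>M) \<le> (\<integral>\<^sup>+ \<omega>. ennreal (norm (C x y 0 \<omega>)) \<partial>M)"
      by (intro nn_integral_mono ennreal_leI) simp
    also have "\<dots> < \<top>"
      using int by (simp add: integrable_iff_bounded)
    finally show ?thesis .
  qed
  then have "(\<integral>\<^sup>+ \<omega>. of_nat CARD('v) * b \<omega> \<partial>M) < \<top>"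
    by (simp add: b_def nn_integral_cmult nn_integral_sum ennreal_mult_less_top of_nat_less_top)
  moreover
  have "AE \<omega> in M. search_cost (edge_cost nedges C \<omega>) z (greedy_search tie nedges C d z w \<omega>) x
      \<le> of_nat CARD('v) * b \<omega>"
    using assms(1)
  proof eventually_elim
    case (elim \<omega>)
    let ?A = "greedy_search tie nedges C d z w \<omega>"
    show ?case
    proof (rule search_cost_bound)
      show "(?A ^^ CARD('v)) x = z"
        unfolding greedy_search_def using elim assms(2) by (rule weighted_greedy_reaches)
      fix u assume "u \<noteq> z"
      then have "(u, ?A u) \<in> edge_set nedges \<omega>"
        using weighted_greedy_candidate(1)[OF elim assms(2)]
        by (auto simp: greedy_search_def nbrs_def)
      then have "ennreal (edge_cost nedges C \<omega> u (?A u)) \<le> ennreal (C u (?A u) 0 \<omega>)"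
        by (intro ennreal_leI edge_cost_le_first)
      also have "\<dots> \<le> b \<omega>"
        by (rule le_b)
      finally show "ennreal (edge_cost nedges C \<omega> u (?A u)) \<le> b \<omega>" .
    qed
  qed
  then have "(\<integral>\<^sup>+ \<omega>. search_cost (edge_cost nedges C \<omega>) z (greedy_search tie nedges C d z w \<omega>) x \<partial>M)
      \<le> (\<integral>\<^sup>+ \<omega>. of_nat CARD('v) * b \<omega> \<partial>M)"
    by (rule nn_integral_mono_AE)
  ultimately
  have "(\<integral>\<^sup>+ \<omega>. search_cost (edge_cost nedges C \<omega>) z (greedy_search tie nedges C d z w \<omega>) x \<partial>M) < \<top>"
    by (rule order.strict_trans1[rotated])
  then show ?thesis
    unfolding weight_step_def expected_cost_def
    by (auto simp: less_top)
qed


section \<open>Cost-greedy search\<close>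

theorem theorem3p1:
  fixes M :: "'a measure"
    and nedges :: "'v::finite \<Rightarrow> 'v \<Rightarrow> 'a \<Rightarrow> nat"
    and C :: "'v \<Rightarrow> 'v \<Rightarrow> nat \<Rightarrow> 'a \<Rightarrow> real"
    and d :: "'v \<Rightarrow> 'v \<Rightarrow> real"
    and tie :: "'v \<Rightarrow> 'v set \<Rightarrow> 'v"
    and z :: 'v
  assumes "random_cost_graph M nedges C"
    and "distance d"
    and "edge_independent M nedges d z"
    and "tie_rule tie"
  shows "\<exists>w. cost_greedy_weights M tie nedges C d z w \<and>
           ((\<forall>x y k. integrable M (C x y k)) \<longrightarrow> (\<forall>x. \<bar>w x\<bar> \<noteq> \<infinity>)) \<and>
           (\<exists>!F. cost_greedy_search M tie nedges C d z F) \<and>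
           (\<forall>w0. weights z w0 \<longrightarrow>
              (\<forall>x. (\<lambda>i. (weight_step M tie nedges C d z ^^ i) w0 x) \<longlonglongrightarrow> w x))"
proof -
  let ?T = "weight_step M tie nedges C d z"
  have adapted: "AE \<omega> in M. adapted d (edge_set nedges \<omega>)"
    using assms(3) by (simp add: edge_independent_def)
  obtain w where fixpoint: "?T w = w" and stable: "\<And>w0 i. CARD('v) \<le> i \<Longrightarrow> (?T ^^ i) w0 = w"
  proof (rule triangular_iteration)
    fix w w' :: "'v \<Rightarrow> ereal" and x
    assume "\<And>y. d y z < d x z \<Longrightarrow> w y = w' y"
    then show "?T w x = ?T w' x"
      by (rule weight_step_cong[OF adapted assms(4)])
  qed (rule that)
  have solution: "cost_greedy_weights M tie nedges C d z w"
    unfolding cost_greedy_weights_def weights_def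
    using fixpoint weight_step_target[of M tie nedges C d z w] by simp
  \<comment> \<open>A solution is a constant orbit of the iteration, hence equal to the common final value.\<close>
  have unique: "w' = w" if "cost_greedy_weights M tie nedges C d z w'" for w'
  proof -
    have "?T w' = w'"
      using that unfolding cost_greedy_weights_def by (intro ext) metis
    then have "(?T ^^ i) w' = w'" for i
      by (induction i) auto
    then show ?thesis
      using stable[of "CARD('v)" w'] by simp
  qed
  have finite_weights: "\<bar>w x\<bar> \<noteq> \<infinity>" if "\<forall>x y k. integrable M (C x y k)" for x
    using weight_step_finite[OF adapted assms(4), where C = C and z = z and w = w and x = x] that
    by (simp add: fixpoint)
  have "AE \<omega> in M. forward_search d (edge_set nedges \<omega>) z (greedy_search tie nedges C d z w \<omega>)"
    using adapted unfolding greedy_search_def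
    by eventually_elim (rule weighted_greedy_forward_search[OF _ assms(4)])
  then have "cost_greedy_search M tie nedges C d z (greedy_search tie nedges C d z w)"
    unfolding cost_greedy_search_def using solution by blast
  moreover have "F = greedy_search tie nedges C d z w"
    if "cost_greedy_search M tie nedges C d z F" for F
    using that unfolding cost_greedy_search_def by (auto dest: unique)
  ultimately have search: "\<exists>!F. cost_greedy_search M tie nedges C d z F"
    by (rule ex1I)
  have attractive: "(\<lambda>i. (?T ^^ i) w0 x) \<longlonglongrightarrow> w x" for w0 x
  proof (rule tendsto_eventually)
    show "\<forall>\<^sub>F i in sequentially. (?T ^^ i) w0 x = w x"
      using eventually_ge_at_top[of "CARD('v)"] by eventually_elim (simp add: stable)
  qed
  show ?thesis
    by (intro exI[of _ w] conjI allI impI solution finite_weights search attractive) blast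
qed

end
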